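(* Let $I_n$ denote the number of unlabeled interval graphs on $n$ vertices. As $n\to\infty$, $$\log I_n \ \ge\ n\log n - 2n\log\log n - O(n);$$ that is, there exist a constant $C>0$ and an integer $N$ such that $\log I_n \ge n\log n - 2n\log\log n - Cn$ for all integers $n\ge N$.
   Context: A simple undirected graph is an interval graph if it is isomorphic to the intersection graph of a family of intervals on the real line: the vertices correspond to the intervals of the family, and two distinct vertices are adjacent if and only if the corresponding intervals have nonempty intersection. The number $I_n$ of unlabeled interval graphs on $n$ vertices is the number of isomorphism classes of interval graphs with exactly $n$ vertices. Here $\log$ is the natural logarithm. *)

theory Defs
  imports
    "HOL-Analysis.Analysis"
    "Graph_Theory.Pair_Digraph"
    "Graph_Theory.Digraph_Isomorphism"
begin

text \<open>
  A finite simple undirected graph is a \<^locale>\<open>pair_graph\<close>: a finite vertex set together with a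
  symmetric irreflexive set of arcs, an undirected edge being the pair of its two orientations.
\<close>

definition intersection_graph :: "'i set \<Rightarrow> ('i \<Rightarrow> 'x set) \<Rightarrow> 'i pair_pre_digraph" where
  "intersection_graph A J =
     \<lparr> pverts = A, parcs = {(u, v). u \<in> A \<and> v \<in> A \<and> u \<noteq> v \<and> J u \<inter> J v \<noteq> {}} \<rparr>"

text \<open>
  Intervals are nonempty; they may be open, closed, half-open, degenerate or unbounded.
  The family is indexed, so different indices may carry the same interval. Since the intersection
  graph has to be isomorphic to the given graph, it is no restriction to take the indices from
  the type of the vertices.
\<close>

definition interval_graph :: "'a pair_pre_digraph \<Rightarrow> bool" where
  "interval_graph G \<longleftrightarrow> pair_graph G \<and>
     (\<exists>(A :: 'a set) (J :: 'a \<Rightarrow> real set).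
        (\<forall>i\<in>A. is_interval (J i) \<and> J i \<noteq> {}) \<and>
        digraph_iso (with_proj G) (with_proj (intersection_graph A J)))"

text \<open>
  Every graph with exactly \<open>n\<close> vertices is isomorphic to one with vertex set \<open>{0, \<dots>, n - 1}\<close>, so
  isomorphism classes are counted among the latter.
\<close>

definition interval_graphs_on :: "nat \<Rightarrow> nat pair_pre_digraph set" where
  "interval_graphs_on n = {G. interval_graph G \<and> pverts G = {..<n}}"

definition graph_iso_on :: "'a pair_pre_digraph set \<Rightarrow> 'a pair_pre_digraph rel" where
  "graph_iso_on S = {(G, H). G \<in> S \<and> H \<in> S \<and> digraph_iso (with_proj G) (with_proj H)}"

definition num_unlabeled_interval_graphs :: "nat \<Rightarrow> nat" where
  "num_unlabeled_interval_graphs n =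
     card (interval_graphs_on n // graph_iso_on (interval_graphs_on n))"

lemma digraph_iso_with_proj_iff:
  assumes "pair_wf_digraph G"
  shows "digraph_iso (with_proj G) (with_proj H) \<longleftrightarrow>
    (\<exists>f. bij_betw f (pverts G) (pverts H) \<and>
         (\<forall>u\<in>pverts G. \<forall>v\<in>pverts G. (u, v) \<in> parcs G \<longleftrightarrow> (f u, f v) \<in> parcs H) \<and>
         parcs H \<subseteq> pverts H \<times> pverts H)" (is "?L \<longleftrightarrow> ?R")
proof -
  interpret pair_wf_digraph G by fact
  have wf: "wf_digraph (with_proj G)" by unfold_locales
  show ?thesis
  proof
    assume ?L
    then obtain h where h: "pre_digraph.digraph_isomorphism (with_proj G) h"
      and H: "with_proj H = app_iso h (with_proj G)"
      unfolding digraph_iso_def by blast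
    from H have eqs: "pverts H = iso_verts h ` pverts G" "parcs H = iso_arcs h ` parcs G"
      "iso_tail h = fst" "iso_head h = snd"
      by (simp_all add: with_proj_def app_iso_def)
    have inj: "inj_on (iso_verts h) (pverts G)"
      and arc: "\<And>a. a \<in> parcs G \<Longrightarrow> iso_arcs h a = (iso_verts h (fst a), iso_verts h (snd a))"
      using h eqs by (auto simp: pre_digraph.digraph_isomorphism_def prod_eq_iff)
    have pH: "parcs H = (\<lambda>(u, v). (iso_verts h u, iso_verts h v)) ` parcs G"
      using arc eqs(2) by (force simp: image_iff)
    show ?R
    proof (intro exI[of _ "iso_verts h"] conjI ballI)
      show "bij_betw (iso_verts h) (pverts G) (pverts H)"
        using inj eqs by (simp add: bij_betw_def)
      show "(u, v) \<in> parcs G \<longleftrightarrow> (iso_verts h u, iso_verts h v) \<in> parcs H"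
        if "u \<in> pverts G" "v \<in> pverts G" for u v
      proof
        assume "(u, v) \<in> parcs G"
        then show "(iso_verts h u, iso_verts h v) \<in> parcs H" unfolding pH by force
      next
        assume "(iso_verts h u, iso_verts h v) \<in> parcs H"
        then obtain x y where xy: "(x, y) \<in> parcs G"
          and eq: "iso_verts h x = iso_verts h u" "iso_verts h y = iso_verts h v"
          unfolding pH by auto
        have "x = u" "y = v"
          using inj_onD[OF inj] eq that in_arcsD1[OF xy] in_arcsD2[OF xy] by blast+
        then show "(u, v) \<in> parcs G" using xy by simp
      qed
      show "parcs H \<subseteq> pverts H \<times> pverts H"
        using pH eqs(1) in_arcsD1 in_arcsD2 by auto
    qed
  next
    assume ?R
    then obtain f where f: "inj_on f (pverts G)" "f ` pverts G = pverts H"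
      and e: "\<And>u v. u \<in> pverts G \<Longrightarrow> v \<in> pverts G \<Longrightarrow> (u, v) \<in> parcs G \<longleftrightarrow> (f u, f v) \<in> parcs H"
      and sub: "parcs H \<subseteq> pverts H \<times> pverts H"
      by (auto simp: bij_betw_def)
    define h where "h = \<lparr> iso_verts = f, iso_arcs = map_prod f f,
      iso_head = snd, iso_tail = (fst :: 'b \<times> 'b \<Rightarrow> 'b) \<rparr>"
    have "map_prod f f ` parcs G = parcs H"
    proof (intro equalityI subsetI)
      fix p assume "p \<in> map_prod f f ` parcs G"
      then obtain u v where uv: "(u, v) \<in> parcs G" "p = (f u, f v)" by auto
      then show "p \<in> parcs H" using e[OF in_arcsD1[OF uv(1)] in_arcsD2[OF uv(1)]] by simp
    next
      fix p assume p: "p \<in> parcs H"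
      then obtain u v where uv: "p = (f u, f v)" "u \<in> pverts G" "v \<in> pverts G"
        using sub f(2) by (cases p) blast
      then have "(u, v) \<in> parcs G" using e p by blast
      then show "p \<in> map_prod f f ` parcs G" using uv(1) by force
    qed
    moreover have "inj_on (map_prod f f) (parcs G)"
    proof (rule inj_on_subset)
      show "inj_on (map_prod f f) (pverts G \<times> pverts G)"
        using f(1) f(1) by (rule map_prod_inj_on)
      show "parcs G \<subseteq> pverts G \<times> pverts G"
        using in_arcsD1 in_arcsD2 by auto
    qed
    ultimately show ?L
      unfolding digraph_iso_def using f wf
      by (intro exI[of _ h])
         (simp add: h_def app_iso_def with_proj_def pre_digraph.digraph_isomorphism_def)
  qed
qed

lemma interval_graphs_on_wf: "G \<in> interval_graphs_on n \<Longrightarrow> pair_wf_digraph G"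
  by (auto simp: interval_graphs_on_def interval_graph_def pair_graph_def pair_digraph_def
      pair_fin_digraph_def)

lemma finite_interval_graphs_on: "finite (interval_graphs_on n)"
proof -
  have "interval_graphs_on n \<subseteq>
      (\<lambda>E. \<lparr> pverts = {..<n}, parcs = E \<rparr>) ` Pow ({..<n} \<times> {..<n})"
  proof
    fix G assume G: "G \<in> interval_graphs_on n"
    interpret pair_wf_digraph G using interval_graphs_on_wf[OF G] .
    have v: "pverts G = {..<n}" using G by (simp add: interval_graphs_on_def)
    then have "parcs G \<subseteq> {..<n} \<times> {..<n}" using in_arcsD1 in_arcsD2 by auto
    moreover have "G = \<lparr> pverts = {..<n}, parcs = parcs G \<rparr>" using v by simp
    ultimately show "G \<in> (\<lambda>E. \<lparr> pverts = {..<n}, parcs = E \<rparr>) ` Pow ({..<n} \<times> {..<n})"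
      by blast
  qed
  then show ?thesis by (rule finite_subset) simp
qed

lemma equiv_graph_iso_on: "equiv (interval_graphs_on n) (graph_iso_on (interval_graphs_on n))"
proof (rule equivI)
  show "graph_iso_on (interval_graphs_on n) \<subseteq> interval_graphs_on n \<times> interval_graphs_on n"
    by (auto simp: graph_iso_on_def)
  show "refl_on (interval_graphs_on n) (graph_iso_on (interval_graphs_on n))"
  proof (rule refl_onI)
    fix G assume G: "G \<in> interval_graphs_on n"
    interpret pair_wf_digraph G using interval_graphs_on_wf[OF G] .
    have "digraph_iso (with_proj G) (with_proj G)"
      unfolding digraph_iso_with_proj_iff[OF interval_graphs_on_wf[OF G]]
      by (rule exI[of _ id]) (auto dest: in_arcsD1 in_arcsD2)
    then show "(G, G) \<in> graph_iso_on (interval_graphs_on n)"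
      using G by (simp add: graph_iso_on_def)
  qed
  show "sym (graph_iso_on (interval_graphs_on n))"
  proof (rule symI)
    fix G H assume "(G, H) \<in> graph_iso_on (interval_graphs_on n)"
    then have G: "G \<in> interval_graphs_on n" and H: "H \<in> interval_graphs_on n"
      and GH: "digraph_iso (with_proj G) (with_proj H)"
      by (auto simp: graph_iso_on_def)
    interpret pair_wf_digraph G using interval_graphs_on_wf[OF G] .
    obtain f where f: "bij_betw f (pverts G) (pverts H)"
      and e: "\<And>u v. u \<in> pverts G \<Longrightarrow> v \<in> pverts G \<Longrightarrow> (u, v) \<in> parcs G \<longleftrightarrow> (f u, f v) \<in> parcs H"
      using GH unfolding digraph_iso_with_proj_iff[OF interval_graphs_on_wf[OF G]] by blast
    let ?g = "inv_into (pverts G) f"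
    have g: "bij_betw ?g (pverts H) (pverts G)" using f by (rule bij_betw_inv_into)
    have "(u, v) \<in> parcs H \<longleftrightarrow> (?g u, ?g v) \<in> parcs G"
      if "u \<in> pverts H" "v \<in> pverts H" for u v
      using that e[of "?g u" "?g v"] f g
      by (auto simp: bij_betw_inv_into_right bij_betwE)
    then have "digraph_iso (with_proj H) (with_proj G)"
      unfolding digraph_iso_with_proj_iff[OF interval_graphs_on_wf[OF H]]
      using g by (intro exI[of _ ?g]) (auto dest: in_arcsD1 in_arcsD2)
    then show "(H, G) \<in> graph_iso_on (interval_graphs_on n)"
      using G H by (simp add: graph_iso_on_def)
  qed
  show "trans (graph_iso_on (interval_graphs_on n))"
  proof (rule transI)
    fix G H K
    assume "(G, H) \<in> graph_iso_on (interval_graphs_on n)"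
      and "(H, K) \<in> graph_iso_on (interval_graphs_on n)"
    then have G: "G \<in> interval_graphs_on n" and H: "H \<in> interval_graphs_on n"
      and K: "K \<in> interval_graphs_on n"
      and GH: "digraph_iso (with_proj G) (with_proj H)"
      and HK: "digraph_iso (with_proj H) (with_proj K)"
      by (auto simp: graph_iso_on_def)
    obtain f where f: "bij_betw f (pverts G) (pverts H)"
      "\<And>u v. u \<in> pverts G \<Longrightarrow> v \<in> pverts G \<Longrightarrow> (u, v) \<in> parcs G \<longleftrightarrow> (f u, f v) \<in> parcs H"
      using GH unfolding digraph_iso_with_proj_iff[OF interval_graphs_on_wf[OF G]] by blast
    obtain g where g: "bij_betw g (pverts H) (pverts K)"
      "\<And>u v. u \<in> pverts H \<Longrightarrow> v \<in> pverts H \<Longrightarrow> (u, v) \<in> parcs H \<longleftrightarrow> (g u, g v) \<in> parcs K"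
      and sub: "parcs K \<subseteq> pverts K \<times> pverts K"
      using HK unfolding digraph_iso_with_proj_iff[OF interval_graphs_on_wf[OF H]] by blast
    have "digraph_iso (with_proj G) (with_proj K)"
      unfolding digraph_iso_with_proj_iff[OF interval_graphs_on_wf[OF G]]
    proof (intro exI[of _ "g \<circ> f"] conjI ballI)
      show "bij_betw (g \<circ> f) (pverts G) (pverts K)"
        using f(1) g(1) by (rule bij_betw_trans)
      show "(u, v) \<in> parcs G \<longleftrightarrow> ((g \<circ> f) u, (g \<circ> f) v) \<in> parcs K"
        if "u \<in> pverts G" "v \<in> pverts G" for u v
        using that f(2)[of u v] g(2)[of "f u" "f v"] f(1) by (auto simp: bij_betwE)
      show "parcs K \<subseteq> pverts K \<times> pverts K" by (rule sub)
    qed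
    then show "(G, K) \<in> graph_iso_on (interval_graphs_on n)"
      using G K by (simp add: graph_iso_on_def)
  qed
qed

end

theory Submission
  imports Defs "HOL-Real_Asymp.Real_Asymp"
begin

text \<open>
  Represent \<open>k\<close> marker vertices by the points \<open>0, \<dots>, k - 1\<close> and the other \<open>n - k\<close> vertices by
  pairwise distinct intervals \<open>[a, b]\<close> with integer endpoints \<open>a \<le> b < k\<close>. The neighbours of a
  vertex among the markers reveal its interval, so an unlabeled graph together with the positions
  of its \<open>k\<close> markers determines the set of intervals, and \<open>I\<^sub>n n\<^sup>k\<close> is at least the number
  of choices of \<open>n - k\<close> intervals among the \<open>k (k + 1) / 2\<close> available ones. Taking
  \<open>k \<approx> n / log n\<close>, the factor \<open>n\<^sup>k\<close> is only exponential in \<open>n\<close>.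
\<close>

definition int_pairs :: "nat \<Rightarrow> (nat \<times> nat) set" where
  "int_pairs k = {(a, b). a \<le> b \<and> b < k}"

lemma int_pairs_eq_Sigma: "int_pairs k = prod.swap ` (SIGMA b:{..<k}. {..b})"
  by (auto simp: int_pairs_def image_iff)

lemma finite_int_pairs [simp]: "finite (int_pairs k)"
  by (simp add: int_pairs_eq_Sigma)

lemma card_int_pairs_ge: "k ^ 2 \<le> 2 * card (int_pairs k)"
proof -
  have "card (int_pairs k) = (\<Sum>b<k. Suc b)"
    by (simp add: int_pairs_eq_Sigma card_image)
  moreover have "k ^ 2 \<le> 2 * (\<Sum>b<k. Suc b)"
    by (induction k) (auto simp: power2_eq_square)
  ultimately show ?thesis by simp
qed

text \<open>Any enumeration would do: \<open>decode\<close> returns the set \<open>S\<close> alone,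
  not which vertex carries which pair.\<close>

definition enum_pairs :: "nat \<Rightarrow> nat \<Rightarrow> (nat \<times> nat) set \<Rightarrow> nat \<Rightarrow> nat \<times> nat" where
  "enum_pairs k n S = (SOME e. bij_betw e {k..<n} S)"

definition marked_interval :: "nat \<Rightarrow> nat \<Rightarrow> (nat \<times> nat) set \<Rightarrow> nat \<Rightarrow> real set" where
  "marked_interval k n S v =
     (if v < k then {real v}
      else {real (fst (enum_pairs k n S v))..real (snd (enum_pairs k n S v))})"

definition marked_graph :: "nat \<Rightarrow> nat \<Rightarrow> (nat \<times> nat) set \<Rightarrow> nat pair_pre_digraph" where
  "marked_graph k n S = intersection_graph {..<n} (marked_interval k n S)"

text \<open>Here \<open>g i\<close> is the vertex playing marker \<open>i\<close>. The vertices
  enter only through adjacency, so \<open>decode\<close> also works on an isomorphic copy of a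
  marked graph, once the markers are located there.\<close>

definition decode :: "nat \<Rightarrow> nat pair_pre_digraph \<Rightarrow> (nat \<Rightarrow> nat) \<Rightarrow> (nat \<times> nat) set" where
  "decode k G g = {(a, b) \<in> int_pairs k.
     \<exists>w \<in> pverts G - g ` {..<k}. {i. i < k \<and> (g i, w) \<in> parcs G} = {a..b}}"

lemma enum_pairs_bij:
  assumes "finite S" "card S = n - k"
  shows "bij_betw (enum_pairs k n S) {k..<n} S"
proof -
  have "\<exists>e. bij_betw e {k..<n} S" by (rule finite_same_card_bij) (use assms in auto)
  then show ?thesis unfolding enum_pairs_def by (rule someI_ex)
qed

lemma intersection_graph_interval_graph:
  fixes J :: "'a \<Rightarrow> real set"
  assumes "finite A" "\<And>i. i \<in> A \<Longrightarrow> is_interval (J i) \<and> J i \<noteq> {}"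
  shows "interval_graph (intersection_graph A J)"
proof -
  let ?G = "intersection_graph A J"
  have pg: "pair_graph ?G"
  proof
    show "finite (parcs ?G)"
      by (rule finite_subset[of _ "A \<times> A"]) (auto simp: intersection_graph_def assms)
  qed (auto simp: intersection_graph_def assms sym_def symmetric_def)
  then interpret pair_graph ?G .
  have "pair_wf_digraph ?G" by unfold_locales
  then have "digraph_iso (with_proj ?G) (with_proj ?G)"
    unfolding digraph_iso_with_proj_iff[OF \<open>pair_wf_digraph ?G\<close>]
    by (intro exI[of _ "id :: 'a \<Rightarrow> 'a"] conjI) (auto simp: intersection_graph_def)
  with pg assms(2) show ?thesis
    unfolding interval_graph_def by (intro conjI exI[of _ A] exI[of _ J]) auto
qed

lemma marked_graph_in_interval_graphs_on:
  assumes "S \<subseteq> int_pairs k" "card S = n - k"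
  shows "marked_graph k n S \<in> interval_graphs_on n"
proof -
  have fin: "finite S" using assms(1) finite_int_pairs by (rule finite_subset)
  have "fst (enum_pairs k n S v) \<le> snd (enum_pairs k n S v)" if "v \<in> {k..<n}" for v
    using bij_betwE[OF enum_pairs_bij[OF fin assms(2)]] that assms(1)
    by (fastforce simp: int_pairs_def)
  then have "interval_graph (marked_graph k n S)"
    unfolding marked_graph_def
    by (intro intersection_graph_interval_graph) (auto simp: marked_interval_def is_interval_convex_1)
  then show ?thesis
    by (simp add: interval_graphs_on_def) (simp add: marked_graph_def intersection_graph_def)
qed

text \<open>The point \<open>i\<close> meets \<open>[a, b]\<close> iff
  \<open>a \<le> i \<le> b\<close>, and an isomorphism keeps the adjacencies between markers and the
  other vertices.\<close>

lemma decode_iso: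
  assumes "S \<subseteq> int_pairs k" "card S = n - k" "k \<le> n"
    and f: "bij_betw f {..<n} (pverts H)"
    and adj: "\<And>u v. u < n \<Longrightarrow> v < n \<Longrightarrow> (u, v) \<in> parcs (marked_graph k n S) \<longleftrightarrow> (f u, f v) \<in> parcs H"
    and g: "\<And>i. i < k \<Longrightarrow> g i = f i"
  shows "decode k H g = S"
proof -
  let ?e = "enum_pairs k n S"
  have fin: "finite S" using assms(1) finite_int_pairs by (rule finite_subset)
  note e = enum_pairs_bij[OF fin assms(2)]
  have nbrs: "{i. i < k \<and> (g i, f v) \<in> parcs H} = {fst (?e v)..snd (?e v)}"
    if v: "v \<in> {k..<n}" for v
  proof -
    have "?e v \<in> int_pairs k" using bij_betwE[OF e] v assms(1) by blast
    \<comment> \<open>The right endpoint is a marker, so restricting to \<open>i < k\<close> does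
      not truncate the interval.\<close>
    then have le: "snd (?e v) < k" by (auto simp: int_pairs_def)
    have "(g i, f v) \<in> parcs H \<longleftrightarrow> i \<in> {fst (?e v)..snd (?e v)}" if i: "i < k" for i
    proof -
      have "(g i, f v) \<in> parcs H \<longleftrightarrow> (i, v) \<in> parcs (marked_graph k n S)"
        using adj[of i v] g i v \<open>k \<le> n\<close> by simp
      also have "\<dots> \<longleftrightarrow> i \<in> {fst (?e v)..snd (?e v)}"
        using i v by (auto simp: marked_graph_def intersection_graph_def marked_interval_def)
      finally show ?thesis .
    qed
    then show ?thesis using le by auto
  qed
  have "pverts H - g ` {..<k} = f ` ({..<n} - {..<k})"
    using f g \<open>k \<le> n\<close> by (subst inj_on_image_set_diff[of f "{..<n}"]) (auto simp: bij_betw_def)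
  also have "{..<n} - {..<k} = {k..<n}" by auto
  finally have "decode k H g =
      {(a, b) \<in> int_pairs k. \<exists>v \<in> {k..<n}. {fst (?e v)..snd (?e v)} = {a..b}}"
    by (simp add: decode_def nbrs)
  \<comment> \<open>Both pairs satisfy \<open>a \<le> b\<close>, and a nonempty integer interval
    determines its endpoints.\<close>
  also have "\<dots> = {p \<in> int_pairs k. \<exists>v \<in> {k..<n}. ?e v = p}"
    using \<open>S \<subseteq> int_pairs k\<close> bij_betwE[OF e] by (force simp: int_pairs_def)
  also have "\<dots> = {p \<in> int_pairs k. p \<in> ?e ` {k..<n}}" by blast
  also have "\<dots> = S" using e assms(1) by (auto simp: bij_betw_def)
  finally show ?thesis .
qed

lemma choose_le_num_unlabeled_interval_graphs:
  assumes "k \<le> n"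
  shows "card (int_pairs k) choose (n - k) \<le> num_unlabeled_interval_graphs n * n ^ k"
proof -
  let ?I = "interval_graphs_on n" and ?r = "graph_iso_on (interval_graphs_on n)"
  define F where "F = {S. S \<subseteq> int_pairs k \<and> card S = n - k}"
  \<comment> \<open>The representative depends on the class alone, so sets with the same class are
    decoded from the same graph and can differ only in their marker positions.\<close>
  define rep :: "nat pair_pre_digraph set \<Rightarrow> nat pair_pre_digraph" where "rep c = (SOME H. H \<in> c)" for c
  define cls where "cls S = ?r `` {marked_graph k n S}" for S
  have "\<exists>g \<in> {..<k} \<rightarrow>\<^sub>E {..<n}. decode k (rep (cls S)) g = S" if "S \<in> F" for S
  proof -
    have S: "S \<subseteq> int_pairs k" "card S = n - k" using that by (auto simp: F_def)
    let ?G = "marked_graph k n S" and ?H = "rep (cls S)"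
    note G = marked_graph_in_interval_graphs_on[OF S]
    have "?G \<in> cls S" unfolding cls_def using equiv_graph_iso_on G by (rule equiv_class_self)
    then have "?H \<in> cls S" unfolding rep_def by (rule someI)
    then have H: "?H \<in> ?I" and iso: "digraph_iso (with_proj ?G) (with_proj ?H)"
      by (auto simp: cls_def graph_iso_on_def)
    obtain f where f: "bij_betw f (pverts ?G) (pverts ?H)"
      and adj: "\<forall>u\<in>pverts ?G. \<forall>v\<in>pverts ?G. (u, v) \<in> parcs ?G \<longleftrightarrow> (f u, f v) \<in> parcs ?H"
      using iso unfolding digraph_iso_with_proj_iff[OF interval_graphs_on_wf[OF G]] by blast
    have verts: "pverts ?G = {..<n}" "pverts ?H = {..<n}"
      using G H by (auto simp: interval_graphs_on_def)
    \<comment> \<open>Restriction puts the marker positions into the extensional function space,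
      which has exactly \<open>n ^ k\<close> elements.\<close>
    have "restrict f {..<k} \<in> {..<k} \<rightarrow>\<^sub>E {..<n}"
      using bij_betwE[OF f] verts assms by auto
    moreover have "decode k ?H (restrict f {..<k}) = S"
      using decode_iso[OF S assms, of f ?H] f adj verts by simp
    ultimately show ?thesis by blast
  qed
  then obtain g where g: "\<And>S. S \<in> F \<Longrightarrow> g S \<in> {..<k} \<rightarrow>\<^sub>E {..<n}"
    and dec: "\<And>S. S \<in> F \<Longrightarrow> decode k (rep (cls S)) (g S) = S"
    by metis
  have "card F \<le> card ((?I // ?r) \<times> ({..<k} \<rightarrow>\<^sub>E {..<n}))"
  proof (rule card_inj_on_le)
    \<comment> \<open>Decoding is a left inverse.\<close>
    show "inj_on (\<lambda>S. (cls S, g S)) F" by (rule inj_onI) (metis dec prod.inject)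
    show "(\<lambda>S. (cls S, g S)) ` F \<subseteq> (?I // ?r) \<times> ({..<k} \<rightarrow>\<^sub>E {..<n})"
      using g marked_graph_in_interval_graphs_on by (auto simp: F_def cls_def intro!: quotientI)
    have "?r \<subseteq> ?I \<times> ?I" by (auto simp: graph_iso_on_def)
    then have "finite (?I // ?r)" using finite_interval_graphs_on by (rule finite_quotient[rotated])
    then show "finite ((?I // ?r) \<times> ({..<k} \<rightarrow>\<^sub>E {..<n}))" by (simp add: finite_PiE)
  qed
  then show ?thesis
    by (simp add: F_def n_subsets card_cartesian_product card_PiE num_unlabeled_interval_graphs_def)
qed

text \<open>With this \<open>k\<close>, \<open>k ln n\<close> is at most \<open>2 n\<close>. This is
  paid twice, for the factor \<open>n ^ k\<close> and for replacing \<open>n - k\<close> by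
  \<open>n\<close> in the exponent; \<open>n ln 2\<close> costs at most one more \<open>n\<close>,
  hence the 5.\<close>

lemma ln_num_unlabeled_interval_graphs_ge:
  fixes n :: nat
  defines "k \<equiv> nat \<lceil>real n / ln (real n)\<rceil>"
  assumes ln_ge: "ln (real n) \<ge> 1" and small: "2 * ln (real n) ^ 2 \<le> real n"
    and kn: "real n / ln (real n) + 1 < real n"
  shows "ln (real (num_unlabeled_interval_graphs n))
    \<ge> real n * ln (real n) - 2 * real n * ln (ln (real n)) - 5 * real n"
proof -
  let ?L = "ln (real n)" and ?K = "card (int_pairs k)" and ?I = "real (num_unlabeled_interval_graphs n)"
  have n: "real n > 0" using ln_ge by (cases "n = 0") auto
  have k_ge: "real n / ?L \<le> real k" unfolding k_def by (rule real_nat_ceiling_ge)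
  have "real n / ?L \<ge> 0" using ln_ge by simp
  then have k_le: "real k \<le> real n / ?L + 1" unfolding k_def by linarith
  have kL: "real k * ?L \<le> 2 * real n"
  proof -
    have "real k * ?L \<le> (real n / ?L + 1) * ?L" using k_le ln_ge by (intro mult_right_mono) auto
    also have "\<dots> = real n + ?L" using ln_ge by (simp add: field_simps)
    \<comment> \<open>The rounding in \<open>k\<close> costs \<open>ln n\<close>, which is less than
      \<open>n\<close>.\<close>
    finally show ?thesis using ln_le_minus_one[OF n] by simp
  qed
  have "k < n" using k_le kn by linarith
  define m where "m = n - k"
  have m: "m > 0" "real m = real n - real k" using \<open>k < n\<close> by (auto simp: m_def)
  \<comment> \<open>A lower bound for \<open>?K / m\<close>, since \<open>?K\<close> is at least
    \<open>k ^ 2 / 2\<close> and \<open>m \<le> n\<close>. The square of \<open>ln n\<close> in it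
    produces the term \<open>2 n ln (ln n)\<close>.\<close>
  let ?q = "real n / (2 * ?L ^ 2)"
  have q1: "?q \<ge> 1" using small ln_ge by (simp add: field_simps)
  have "?q * real m \<le> ?q * real n" using m q1 by (intro mult_left_mono) auto
  also have "\<dots> = (real n / ?L) ^ 2 / 2" by (simp add: power2_eq_square)
  also have "\<dots> \<le> real k ^ 2 / 2"
    using k_ge n ln_ge by (intro divide_right_mono power_mono) auto
  also have "\<dots> \<le> real ?K"
    using card_int_pairs_ge[of k, THEN of_nat_mono[where ?'a = real]] by simp
  finally have qK: "?q * real m \<le> real ?K" .
  have "m \<le> ?K" using qK q1 mult_right_mono[OF q1, of "real m"] by simp
  have "?q ^ m \<le> (real ?K / real m) ^ m"
  proof (rule power_mono)
    show "?q \<le> real ?K / real m" using qK m(1) by (simp only: pos_le_divide_eq of_nat_0_less_iff)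
  qed (use q1 in linarith)
  also have "\<dots> \<le> real (?K choose m)" using \<open>m \<le> ?K\<close> by (rule binomial_ge_n_over_k_pow_k)
  also have "\<dots> \<le> ?I * real n ^ k"
    using choose_le_num_unlabeled_interval_graphs[of k n, THEN of_nat_mono[where ?'a = real]] \<open>k < n\<close>
    by (simp add: m_def)
  finally have main: "?q ^ m \<le> ?I * real n ^ k" .
  have qpos: "?q > 0" using q1 by linarith
  \<comment> \<open>Positivity of the count comes from \<open>main\<close> itself and allows taking
    logarithms of the product.\<close>
  have I: "?I > 0"
    using less_le_trans[OF zero_less_power[OF qpos, of m] main] n by (simp add: zero_less_mult_iff)
  have "real m * ln ?q = ln (?q ^ m)" using qpos by (simp add: ln_realpow)
  also have "\<dots> \<le> ln (?I * real n ^ k)" using main qpos I n by simp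
  also have "\<dots> = ln ?I + real k * ?L" using I n by (simp add: ln_mult ln_realpow)
  finally have fin: "real m * ln ?q \<le> ln ?I + real k * ?L" .
  have lnq: "ln ?q = ?L - 2 * ln ?L - ln 2"
    using n ln_ge by (cases "n = 1") (auto simp: ln_div ln_mult ln_realpow)
  \<comment> \<open>This bounds the loss \<open>k ln ?q\<close> from passing from exponent
    \<open>m\<close> to \<open>n\<close>.\<close>
  have "ln ?q \<le> ?L" using ln_ge_zero[OF ln_ge] ln_gt_zero[of "2::real"] unfolding lnq by linarith
  then have "real k * ln ?q \<le> real k * ?L" by (intro mult_left_mono) auto
  moreover have "real m * ln ?q = real n * ln ?q - real k * ln ?q" by (simp add: m left_diff_distrib)
  ultimately have "real n * ln ?q - 2 * (real k * ?L) \<le> ln ?I" using fin by linarith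
  moreover have "real n * ln ?q = real n * ?L - 2 * real n * ln ?L - real n * ln 2"
    by (simp add: lnq algebra_simps)
  moreover have "real n * ln 2 \<le> real n * 1"
    using ln_le_minus_one[of "2::real"] by (intro mult_left_mono) auto
  ultimately show ?thesis using kL by linarith
qed

theorem theorem1:
  shows "\<exists>C::real. C > 0 \<and> (\<exists>N::nat. \<forall>n\<ge>N.
    ln (real (num_unlabeled_interval_graphs n))
      \<ge> real n * ln (real n) - 2 * real n * ln (ln (real n)) - C * real n)"
proof (rule exI[of _ 5], rule conjI)
  \<comment> \<open>The second condition makes \<open>?q\<close> at least 1, the third leaves room
    for at least one vertex besides the markers.\<close>
  have "\<forall>\<^sub>F n in sequentially. ln (real n) \<ge> 1"
    and "\<forall>\<^sub>F n in sequentially. 2 * ln (real n) ^ 2 \<le> real n"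
    and "\<forall>\<^sub>F n in sequentially. real n / ln (real n) + 1 < real n"
    by real_asymp+
  then have "\<forall>\<^sub>F n in sequentially. ln (real (num_unlabeled_interval_graphs n))
      \<ge> real n * ln (real n) - 2 * real n * ln (ln (real n)) - 5 * real n"
    by eventually_elim (rule ln_num_unlabeled_interval_graphs_ge)
  then show "\<exists>N::nat. \<forall>n\<ge>N. ln (real (num_unlabeled_interval_graphs n))
      \<ge> real n * ln (real n) - 2 * real n * ln (ln (real n)) - 5 * real n"
    by (simp add: eventually_sequentially)
qed simp

end
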